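(* Let $V$ be a finite set with $n=|V|$, let $k\ge 2$ be an integer, and let $P=\{1,\dots,k\}$. Let $\mathcal{R}^{Z}_{\mathrm{BQO}}\subset\mathbb{R}^{n\times k}\times\mathbb{R}^{n\times n}$ and $\mathcal{R}_{\mathrm{MISDO\text{-}I}}\subset\mathbb{R}^{n\times n}$ be the sets defined in the context, and let $\operatorname{proj}_{Z}\mathcal{R}^{Z}_{\mathrm{BQO}}=\{Z : \exists x,\ (x,Z)\in\mathcal{R}^{Z}_{\mathrm{BQO}}\}$. Then $\operatorname{proj}_{Z}\mathcal{R}^{Z}_{\mathrm{BQO}}\subseteq\mathcal{R}_{\mathrm{MISDO\text{-}I}}$.
   Context: $V$ is the vertex set of the graph in a max $k$-cut instance. $e\in\mathbb{R}^n$ is the all-ones vector, and $A\succeq B$ means that $A-B$ is symmetric positive semidefinite. For $x=(x_{vj})_{v\in V,\,j\in P}\in[0,1]^{n\times k}$ and $j\in P$, let $\mathbf{x}_j\in[0,1]^n$ be the vector with entries $(\mathbf{x}_j)_v=x_{vj}$ for $v\in V$, and let $D^x$ be the $n\times n$ diagonal matrix with $D^x_{vv}=1-\sum_{j\in P}x_{vj}^2$. The lifted continuous relaxation of the binary quadratic optimization (BQO) formulation in $Z$-space is $$\mathcal{R}^{Z}_{\mathrm{BQO}}=\Big\{(x,Z)\in[0,1]^{n\times k}\times\mathbb{R}^{n\times n} : \sum_{j\in P}x_{vj}=1\ \ \forall v\in V,\quad Z=D^x+\sum_{j\in P}\mathbf{x}_j\mathbf{x}_j^T\Big\}.$$ The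 continuous relaxation of the first mixed integer semidefinite optimization (MISDO-I) formulation is $$\mathcal{R}_{\mathrm{MISDO\text{-}I}}=\Big\{Z\in[0,1]^{n\times n} : Z_{vv}=1\ \ \forall v\in V,\quad kZ\succeq ee^T\Big\}.$$ *)

theory Defs
  imports "HOL-Analysis.Analysis"
begin

text \<open>
  The finite types \<open>'v\<close> and \<open>'p\<close> stand for the index sets \<open>V\<close> and \<open>P\<close>, so \<open>n = CARD('v)\<close> and
  \<open>k = CARD('p)\<close>. A point \<open>x\<close> has type \<open>real^'p^'v\<close>, with \<open>x $ v $ j\<close> for the entry \<open>(v, j)\<close>;
  its \<open>j\<close>-th column vector is the library's \<open>column j x\<close>.
\<close>

definition outer :: "real^'v \<Rightarrow> real^'v \<Rightarrow> real^'v^'v" where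
  "outer a b = (\<chi> u v. a $ u * b $ v)"

definition psd :: "real^'v^'v \<Rightarrow> bool" where
  "psd A \<longleftrightarrow> transpose A = A \<and> (\<forall>y. 0 \<le> y \<bullet> (A *v y))"

definition loewner_ge :: "real^'v^'v \<Rightarrow> real^'v^'v \<Rightarrow> bool" (infix "\<succeq>" 50) where
  "A \<succeq> B \<longleftrightarrow> psd (A - B)"

definition D_mat :: "real^'p^'v \<Rightarrow> real^'v^'v" where
  "D_mat x = (\<chi> u v. if u = v then 1 - (\<Sum>j\<in>UNIV. (x $ v $ j)\<^sup>2) else 0)"

definition R_BQO_Z :: "((real^'p^'v) \<times> (real^'v^'v)) set" where
  "R_BQO_Z = {(x, Z).
     (\<forall>v j. x $ v $ j \<in> {0..1}) \<and>
     (\<forall>v. (\<Sum>j\<in>UNIV. x $ v $ j) = 1) \<and>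
     Z = D_mat x + (\<Sum>j\<in>UNIV. outer (column j x) (column j x))}"

definition R_MISDO_I :: "nat \<Rightarrow> (real^'v^'v) set" where
  "R_MISDO_I k = {Z.
     (\<forall>u v. Z $ u $ v \<in> {0..1}) \<and>
     (\<forall>v. Z $ v $ v = 1) \<and>
     real k *\<^sub>R Z \<succeq> outer (vec 1) (vec 1)}"

end

theory Submission
  imports Defs
begin

text \<open>
  The entries of \<open>Z\<close> off the diagonal are \<open>\<Sum>\<^sub>j x\<^sub>u\<^sub>j x\<^sub>v\<^sub>j\<close>, which lie between \<open>0\<close> and
  \<open>\<Sum>\<^sub>j x\<^sub>u\<^sub>j = 1\<close>; the matrix \<open>D\<^sup>x\<close> is chosen so that the diagonal is \<open>1\<close>, and it is itself
  nonnegative because \<open>x\<^sub>v\<^sub>j\<^sup>2 \<le> x\<^sub>v\<^sub>j\<close>. For the semidefinite constraint, put \<open>s\<^sub>j = x\<^sub>j \<bullet> y\<close>, where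
  \<open>x\<^sub>j\<close> is the \<open>j\<close>-th column of \<open>x\<close>. As the columns of \<open>x\<close> add up to the all-ones vector,
  \<open>e \<bullet> y = \<Sum>\<^sub>j s\<^sub>j\<close>, so that the quadratic form of \<open>k Z - e e\<^sup>T\<close> at \<open>y\<close> is
  \<open>k \<Sum>\<^sub>v D\<^sup>x\<^sub>v\<^sub>v y\<^sub>v\<^sup>2 + (k \<Sum>\<^sub>j s\<^sub>j\<^sup>2 - (\<Sum>\<^sub>j s\<^sub>j)\<^sup>2)\<close>. Its first part is nonnegative, and so is its
  second part, by the Cauchy-Schwarz inequality.
\<close>

lemma quadratic_form_outer:
  fixes a b y :: "real^'v"
  shows "y \<bullet> (outer a b *v y) = (a \<bullet> y) * (b \<bullet> y)"
  unfolding inner_vec_def sum_product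
  by (simp add: outer_def matrix_vector_mult_def sum_distrib_left mult_ac)

lemma quadratic_form_sum:
  fixes M :: "'i \<Rightarrow> real^'v^'v"
  shows "y \<bullet> ((\<Sum>i\<in>I. M i) *v y) = (\<Sum>i\<in>I. y \<bullet> (M i *v y))"
  by (induction I rule: infinite_finite_induct)
    (simp_all add: matrix_vector_mult_add_rdistrib inner_add_right)

lemma quadratic_form_D_mat:
  fixes x :: "real^'p^'v"
  shows "y \<bullet> (D_mat x *v y) = (\<Sum>v\<in>UNIV. (1 - (\<Sum>j\<in>UNIV. (x $ v $ j)\<^sup>2)) * (y $ v)\<^sup>2)"
proof -
  have "(D_mat x *v y) $ v = (1 - (\<Sum>j\<in>UNIV. (x $ v $ j)\<^sup>2)) * y $ v" for v
    by (simp add: D_mat_def matrix_vector_mult_def if_distrib [of "\<lambda>c. c * _"] cong: if_cong)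
  then show ?thesis
    by (simp add: inner_vec_def power2_eq_square mult_ac)
qed

text \<open>This bounds the entries of \<open>Z\<close> off the diagonal and, with \<open>u = v\<close>, shows that the
  diagonal entries of \<open>D_mat x\<close> are nonnegative.\<close>

lemma inner_rows_bounds:
  fixes x :: "real^'p^'v"
  assumes "\<And>v j. x $ v $ j \<in> {0..1}" and "\<And>v. (\<Sum>j\<in>UNIV. x $ v $ j) = 1"
  shows "(\<Sum>j\<in>UNIV. x $ u $ j * x $ v $ j) \<in> {0..1}"
proof -
  have "(\<Sum>j\<in>UNIV. x $ u $ j * x $ v $ j) \<le> (\<Sum>j\<in>UNIV. x $ u $ j)"
    using assms(1) by (intro sum_mono mult_left_le) auto
  moreover have "0 \<le> (\<Sum>j\<in>UNIV. x $ u $ j * x $ v $ j)"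
    using assms(1) by (intro sum_nonneg mult_nonneg_nonneg) auto
  ultimately show ?thesis
    using assms(2) by simp
qed

lemma entry_of_BQO_matrix:
  fixes x :: "real^'p^'v"
  shows "(D_mat x + (\<Sum>j\<in>UNIV. outer (column j x) (column j x))) $ u $ v =
    (if u = v then 1 else \<Sum>j\<in>UNIV. x $ u $ j * x $ v $ j)"
  by (simp add: D_mat_def outer_def column_def power2_eq_square)

text \<open>The factor \<open>k\<close> in \<open>k Z\<close> is the one of the Cauchy-Schwarz inequality
  \<open>(\<Sum>\<^sub>j s\<^sub>j)\<^sup>2 \<le> k \<Sum>\<^sub>j s\<^sub>j\<^sup>2\<close>.\<close>

lemma loewner_ge_all_ones:
  fixes x :: "real^'p^'v"
  assumes box: "\<And>v j. x $ v $ j \<in> {0..1}" and row: "\<And>v. (\<Sum>j\<in>UNIV. x $ v $ j) = 1"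
    and Z: "Z = D_mat x + (\<Sum>j\<in>UNIV. outer (column j x) (column j x))"
  shows "real CARD('p) *\<^sub>R Z \<succeq> outer (vec 1) (vec 1)"
  unfolding loewner_ge_def psd_def
proof (intro conjI allI)
  show "transpose (real CARD('p) *\<^sub>R Z - outer (vec 1) (vec 1)) =
      real CARD('p) *\<^sub>R Z - outer (vec 1) (vec 1)"
  proof -
    have "Z $ u $ v = Z $ v $ u" for u v
      unfolding Z entry_of_BQO_matrix by (simp add: mult.commute)
    then show ?thesis
      by (simp add: vec_eq_iff transpose_def outer_def)
  qed
next
  fix y :: "real^'v"
  define s where "s j = column j x \<bullet> y" for j
  have ones: "vec 1 \<bullet> y = (\<Sum>j\<in>UNIV. s j)"
  proof -
    have "vec 1 = (\<Sum>j\<in>UNIV. column j x)"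
      by (simp add: vec_eq_iff column_def row)
    then show ?thesis
      by (simp only: s_def inner_sum_left)
  qed
  have D: "0 \<le> y \<bullet> (D_mat x *v y)"
    unfolding quadratic_form_D_mat
    using inner_rows_bounds [OF box row]
    by (intro sum_nonneg mult_nonneg_nonneg) (simp_all add: power2_eq_square)
  have form: "y \<bullet> (Z *v y) = y \<bullet> (D_mat x *v y) + (\<Sum>j\<in>UNIV. (s j)\<^sup>2)"
    by (simp add: Z matrix_vector_mult_add_rdistrib inner_add_right quadratic_form_sum
        quadratic_form_outer s_def power2_eq_square)
  have "(vec 1 \<bullet> y)\<^sup>2 \<le> real CARD('p) * (\<Sum>j\<in>UNIV. (s j)\<^sup>2)"
    unfolding ones
    using sum_squared_le_sum_of_squares [of s "UNIV :: 'p set"] by (simp add: mult.commute)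
  also have "\<dots> \<le> real CARD('p) * (y \<bullet> (Z *v y))"
    using D by (intro mult_left_mono) (simp_all add: form)
  finally show "0 \<le> y \<bullet> ((real CARD('p) *\<^sub>R Z - outer (vec 1) (vec 1)) *v y)"
    by (simp add: matrix_vector_mult_diff_rdistrib inner_diff_right quadratic_form_outer
        power2_eq_square flip: scaleR_matrix_vector_assoc)
qed

theorem theorem4:
  assumes "CARD('p::finite) \<ge> 2"
  shows "{Z :: real^'v^'v. \<exists>x :: real^'p^'v. (x, Z) \<in> R_BQO_Z} \<subseteq> R_MISDO_I (CARD('p))"
proof
  fix Z :: "real^'v^'v"
  assume "Z \<in> {Z. \<exists>x :: real^'p^'v. (x, Z) \<in> R_BQO_Z}"
  then obtain x :: "real^'p^'v" where box: "\<And>v j. x $ v $ j \<in> {0..1}"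
    and row: "\<And>v. (\<Sum>j\<in>UNIV. x $ v $ j) = 1"
    and Z: "Z = D_mat x + (\<Sum>j\<in>UNIV. outer (column j x) (column j x))"
    unfolding R_BQO_Z_def by blast
  have "Z $ u $ v \<in> {0..1}" for u v
    using inner_rows_bounds [OF box row, of u v] unfolding Z entry_of_BQO_matrix by simp
  moreover have "Z $ v $ v = 1" for v
    unfolding Z entry_of_BQO_matrix by simp
  ultimately show "Z \<in> R_MISDO_I (CARD('p))"
    using loewner_ge_all_ones [OF box row Z] unfolding R_MISDO_I_def by blast
qed

end
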